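(* For every integer $n\ge 0$, $$B_{2n+2}=3\cdot\sum_{i=0}^{n}1^{n-i}B_{2i+1},$$ $$B_{3n+3}=10\cdot\sum_{i=0}^{n}3^{n-i}B_{3i+1},$$ $$B_{4n+4}=33\cdot\sum_{i=0}^{n}10^{n-i}B_{4i+1}.$$
   Context: $B_n$ denotes the "bronze Fibonacci numbers": $B_0=0$, $B_1=1$, $B_n=3B_{n-1}+B_{n-2}$. *)

theory Defs imports Main begin

fun bronze_fib :: "nat \<Rightarrow> nat" where
  "bronze_fib 0 = 0"
| "bronze_fib (Suc 0) = 1"
| "bronze_fib (Suc (Suc n)) = 3 * bronze_fib (Suc n) + bronze_fib n"

end

theory Submission imports Defs begin

text \<open>
  All three identities are the cases \<open>k = 2, 3, 4\<close> of one: for every \<open>k \<ge> 1\<close>,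
  \<open>B (k * n + k) = B k * (\<Sum>i = 0..n. B (k - 1) ^ (n - i) * B (k * i + 1))\<close>.
  The constants \<open>3, 10, 33\<close> are \<open>B 2, B 3, B 4\<close>, and the ratios \<open>1, 3, 10\<close> are the
  preceding terms \<open>B 1, B 2, B 3\<close>. The addition formula
  \<open>B (m + k) = B k * B (m + 1) + B (k - 1) * B m\<close>, read at multiples \<open>m\<close> of \<open>k\<close>, is a
  first-order linear recurrence for \<open>B\<close> along those multiples, with ratio \<open>B (k - 1)\<close>
  and inhomogeneous term \<open>B k * B (m + 1)\<close>. Unrolling it from \<open>B 0 = 0\<close> gives the sum.
\<close>

text \<open>
  Both sides satisfy the defining recurrence as functions of \<open>k\<close>, so agreement at two
  consecutive indices suffices. Writing \<open>Suc k\<close> for the added index avoids truncated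
  subtraction.
\<close>
lemma bronze_fib_add:
  "bronze_fib (m + Suc k) = bronze_fib (Suc k) * bronze_fib (m + 1) + bronze_fib k * bronze_fib m"
  by (induction k rule: bronze_fib.induct) (simp_all add: algebra_simps)

lemma bronze_fib_multiple_eq_sum:
  "bronze_fib (Suc k * n + Suc k) =
     bronze_fib (Suc k) * (\<Sum>i = 0..n. bronze_fib k ^ (n - i) * bronze_fib (Suc k * i + 1))"
proof (induction n)
  case 0
  show ?case by simp
next
  case (Suc n)
  let ?S = "\<lambda>n. \<Sum>i = 0..n. bronze_fib k ^ (n - i) * bronze_fib (Suc k * i + 1)"
  have "(\<Sum>i = 0..n. bronze_fib k ^ (Suc n - i) * bronze_fib (Suc k * i + 1))
      = bronze_fib k * ?S n"
    unfolding sum_distrib_left by (rule sum.cong) (simp_all add: Suc_diff_le mult.assoc)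
  then have step: "?S (Suc n) = bronze_fib k * ?S n + bronze_fib (Suc k * Suc n + 1)"
    by (simp only: sum.atLeast0_atMost_Suc diff_self_eq_0 power_0 mult_1)
  have "bronze_fib (Suc k * Suc n + Suc k)
      = bronze_fib (Suc k) * bronze_fib (Suc k * Suc n + 1) + bronze_fib k * bronze_fib (Suc k * Suc n)"
    by (rule bronze_fib_add)
  also have "bronze_fib (Suc k * Suc n) = bronze_fib (Suc k) * ?S n"
    using Suc.IH by (simp only: mult_Suc_right add.commute)
  finally show ?case
    unfolding step by (simp only: distrib_left mult.left_commute add.commute)
qed

theorem mainTheorem5:
  fixes n :: nat
  shows "bronze_fib (2 * n + 2) = 3 * (\<Sum>i = 0..n. 1 ^ (n - i) * bronze_fib (2 * i + 1))
       \<and> bronze_fib (3 * n + 3) = 10 * (\<Sum>i = 0..n. 3 ^ (n - i) * bronze_fib (3 * i + 1))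
       \<and> bronze_fib (4 * n + 4) = 33 * (\<Sum>i = 0..n. 10 ^ (n - i) * bronze_fib (4 * i + 1))"
proof -
  have B: "bronze_fib 1 = 1" "bronze_fib 2 = 3" "bronze_fib 3 = 10" "bronze_fib 4 = 33"
    by (simp_all add: numeral_eq_Suc)
  have S: "Suc 1 = 2" "Suc 2 = 3" "Suc 3 = 4"
    by simp_all
  show ?thesis
    using bronze_fib_multiple_eq_sum[of 1 n] bronze_fib_multiple_eq_sum[of 2 n]
      bronze_fib_multiple_eq_sum[of 3 n]
    unfolding S B by blast
qed

end
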